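(* Let $\mathbb{K}=\mathbb{R}$ or $\mathbb{K}=\mathbb{C}$ and let $(\Omega,\Sigma,\mu)$ be a measure space. Let $f,g,h\in L^2(\Omega,\mathbb{K})$ and $\varphi,\Phi,\gamma,\Gamma\in\mathbb{K}$ be such that $\int_\Omega |h(s)|^2\,d\mu(s)=1$ and $$\int_\Omega \operatorname{Re}\left[(\Phi h(s)-f(s))\left(\overline{f(s)}-\overline{\varphi}\,\overline{h(s)}\right)\right]d\mu(s)\ge 0,$$ $$\int_\Omega \operatorname{Re}\left[(\Gamma h(s)-g(s))\left(\overline{g(s)}-\overline{\gamma}\,\overline{h(s)}\right)\right]d\mu(s)\ge 0,$$ or, equivalently, $$\left(\int_\Omega\left|f(s)-\frac{\Phi+\varphi}{2}h(s)\right|^2d\mu(s)\right)^{\frac12}\le\frac12|\Phi-\varphi|,\qquad \left(\int_\Omega\left|g(s)-\frac{\Gamma+\gamma}{2}h(s)\right|^2d\mu(s)\right)^{\frac12}\le\frac12|\Gamma-\gamma|.$$ Then $$\left|\int_\Omega f(s)\overline{g(s)}\,d\mu(s)-\int_\Omega f(s)\overline{h(s)}\,d\mu(s)\int_\Omega h(s)\overline{g(s)}\,d\mu(s)\right|$$ $$\le\frac14|\Phi-\varphi|\cdot|\Gamma-\gamma|-\left[\int_\Omega \operatorname{Re}\left[(\Phi h(s)-f(s))\left(\overline{f(s)}-\overline{\varphi}\,\overline{h(s)}\right)\right]d\mu(s)\cdot\int_\Omega \operatorname{Re}\left[(\Gamma h(s)-g(s))\left(\overline{g(s)}-\overline{\gamma}\,\overline{h(s)}\right)\right]d\mu(s)\right]^{\frac12}.$$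 The constant $\frac14$ is best possible, i.e. for every real $c<\frac14$ there exist a measure space $(\Omega,\Sigma,\mu)$, functions $f,g,h\in L^2(\Omega,\mathbb{K})$ and scalars $\varphi,\Phi,\gamma,\Gamma\in\mathbb{K}$ satisfying $\int_\Omega |h(s)|^2\,d\mu(s)=1$, $\int_\Omega \operatorname{Re}\left[(\Phi h(s)-f(s))\left(\overline{f(s)}-\overline{\varphi}\,\overline{h(s)}\right)\right]d\mu(s)\ge 0$ and $\int_\Omega \operatorname{Re}\left[(\Gamma h(s)-g(s))\left(\overline{g(s)}-\overline{\gamma}\,\overline{h(s)}\right)\right]d\mu(s)\ge 0$ for which the inequality with $\frac14$ replaced by $c$, namely $$\left|\int_\Omega f(s)\overline{g(s)}\,d\mu(s)-\int_\Omega f(s)\overline{h(s)}\,d\mu(s)\int_\Omega h(s)\overline{g(s)}\,d\mu(s)\right|$$ $$\le c\,|\Phi-\varphi|\cdot|\Gamma-\gamma|-\left[\int_\Omega \operatorname{Re}\left[(\Phi h(s)-f(s))\left(\overline{f(s)}-\overline{\varphi}\,\overline{h(s)}\right)\right]d\mu(s)\cdot\int_\Omega \operatorname{Re}\left[(\Gamma h(s)-g(s))\left(\overline{g(s)}-\overline{\gamma}\,\overline{h(s)}\right)\right]d\mu(s)\right]^{\frac12},$$ fails.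
   Context: $\mu$ is a countably additive positive measure on the $\sigma$-algebra $\Sigma$ of subsets of $\Omega$, with values in $\mathbb{R}\cup\{\infty\}$. $L^2(\Omega,\mathbb{K})$ is the Hilbert space of $\mathbb{K}$-valued (measurable) functions $f$ on $\Omega$ with $\int_\Omega|f(s)|^2\,d\mu(s)<\infty$, with inner product $\langle f,g\rangle=\int_\Omega f(s)\overline{g(s)}\,d\mu(s)$. *)

theory Defs
  imports "HOL-Analysis.Analysis"
begin

text \<open>Elements are functions, not classes modulo equality almost everywhere.\<close>

definition L2_space :: "'a measure \<Rightarrow> ('a \<Rightarrow> 'k::real_normed_field) set" where
  "L2_space M = {f \<in> borel_measurable M. integrable M (\<lambda>s. (norm (f s))\<^sup>2)}"

definition gap_complex ::
  "'a measure \<Rightarrow> ('a \<Rightarrow> complex) \<Rightarrow> complex \<Rightarrow> complex \<Rightarrow> ('a \<Rightarrow> complex) \<Rightarrow> real" where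
  "gap_complex M h \<phi> \<Phi> f =
     (\<integral>s. Re ((\<Phi> * h s - f s) * (cnj (f s) - cnj \<phi> * cnj (h s))) \<partial>M)"

text \<open>For real scalars conjugation and real part are the identity.\<close>

definition gap_real ::
  "'a measure \<Rightarrow> ('a \<Rightarrow> real) \<Rightarrow> real \<Rightarrow> real \<Rightarrow> ('a \<Rightarrow> real) \<Rightarrow> real" where
  "gap_real M h \<phi> \<Phi> f = (\<integral>s. (\<Phi> * h s - f s) * (f s - \<phi> * h s) \<partial>M)"

end

theory Submission
  imports Defs
begin

text \<open>
  Write \<open>\<langle>u,v\<rangle>\<close> for the inner product of \<open>L\<^sup>2\<close> and let \<open>w = f - ((\<Phi> + \<phi>)/2) h\<close>. The two factors under
  the integral sign of the gap are \<open>(\<Phi> - \<phi>)/2 h - w\<close> and the conjugate of \<open>(\<Phi> - \<phi>)/2 h + w\<close>, and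
  \<open>Re ((a - b) cnj (a + b)) = \<bar>a\<bar>\<^sup>2 - \<bar>b\<bar>\<^sup>2\<close>; since \<open>h\<close> is a unit vector, the gap of \<open>f\<close> is therefore
  \<open>\<bar>\<Phi> - \<phi>\<bar>\<^sup>2/4 - \<parallel>w\<parallel>\<^sup>2\<close> (lemma \<open>gap_complex_eq\<close>). The equivalence of the two forms of the hypothesis
  is read off from this.

  For the inequality, let \<open>v = f - \<langle>f,h\<rangle> h\<close> be the component of \<open>f\<close> orthogonal to \<open>h\<close>. Because \<open>v\<close> is
  orthogonal to \<open>h\<close>, the left-hand side \<open>\<langle>f,g\<rangle> - \<langle>f,h\<rangle>\<langle>h,g\<rangle> = \<langle>v,g\<rangle>\<close> does not change when a
  multiple of \<open>h\<close> is subtracted from \<open>g\<close>; and \<open>v\<close> is the shortest vector of the form \<open>f - d h\<close>. So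
  Cauchy-Schwarz bounds the left-hand side by \<open>\<parallel>f - d h\<parallel> \<parallel>g - e h\<parallel>\<close> for all scalars \<open>d\<close> and \<open>e\<close>
  (lemma \<open>Gruss_bound\<close>). Taking the midpoints for \<open>d\<close> and \<open>e\<close> turns the two norms into
  \<open>sqrt (m\<^sup>2 - p)\<close> and \<open>sqrt (n\<^sup>2 - q)\<close>, where \<open>m\<close>, \<open>n\<close> are the half-diameters and \<open>p\<close>, \<open>q\<close> the gaps,
  and Aczel's inequality \<open>sqrt ((m\<^sup>2 - p) (n\<^sup>2 - q)) \<le> m n - sqrt (p q)\<close> concludes.

  The real statement is the complex one for functions with values on the real axis. Equality with
  vanishing gaps occurs for \<open>f = g\<close> a fair random sign, \<open>h = 1\<close> and the bounds \<open>\<plusminus>1\<close>: both sides are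
  then \<open>1 = 2 \<sqdot> 2 / 4\<close>, so no constant below \<open>1/4\<close> is possible.
\<close>

section \<open>The inner product of square-integrable complex functions\<close>

definition l2_inner :: "'a measure \<Rightarrow> ('a \<Rightarrow> complex) \<Rightarrow> ('a \<Rightarrow> complex) \<Rightarrow> complex" where
  "l2_inner M u v = (\<integral>s. u s * cnj (v s) \<partial>M)"

definition l2_sqnorm :: "'a measure \<Rightarrow> ('a \<Rightarrow> complex) \<Rightarrow> real" where
  "l2_sqnorm M u = (\<integral>s. (cmod (u s))\<^sup>2 \<partial>M)"

lemma L2_measurable: "u \<in> L2_space M \<Longrightarrow> u \<in> borel_measurable M"
  and L2_integrable: "u \<in> L2_space M \<Longrightarrow> integrable M (\<lambda>s. (norm (u s))\<^sup>2)"
  by (auto simp: L2_space_def)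

lemma l2_sqnorm_nonneg: "0 \<le> l2_sqnorm M u"
  by (simp add: l2_sqnorm_def)

lemma L2_scale:
  fixes u :: "'a \<Rightarrow> complex"
  assumes "u \<in> L2_space M"
  shows "(\<lambda>s. c * u s) \<in> L2_space M"
  using assms by (auto simp: L2_space_def norm_mult power_mult_distrib)

lemma L2_integrable_mult_cnj:
  fixes u v :: "'a \<Rightarrow> complex"
  assumes u: "u \<in> L2_space M" and v: "v \<in> L2_space M"
  shows "integrable M (\<lambda>s. u s * cnj (v s))"
proof (rule Bochner_Integration.integrable_bound)
  show "integrable M (\<lambda>s. (cmod (u s))\<^sup>2 + (cmod (v s))\<^sup>2)"
    using u v by (intro Bochner_Integration.integrable_add L2_integrable)
  have [measurable]: "cnj \<in> borel_measurable borel"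
    by (intro borel_measurable_continuous_onI continuous_intros)
  show "(\<lambda>s. u s * cnj (v s)) \<in> borel_measurable M"
    using L2_measurable[OF u] L2_measurable[OF v] by measurable
  have "cmod (u s * cnj (v s)) \<le> norm ((cmod (u s))\<^sup>2 + (cmod (v s))\<^sup>2)" for s
    using sum_squares_bound[of "cmod (u s)" "cmod (v s)"]
      mult_nonneg_nonneg[OF norm_ge_zero norm_ge_zero, of "u s" "v s"]
    unfolding norm_mult complex_mod_cnj real_norm_def by linarith
  then show "AE s in M. cmod (u s * cnj (v s)) \<le> norm ((cmod (u s))\<^sup>2 + (cmod (v s))\<^sup>2)"
    by simp
qed

lemma L2_diff:
  fixes u v :: "'a \<Rightarrow> complex"
  assumes u: "u \<in> L2_space M" and v: "v \<in> L2_space M"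
  shows "(\<lambda>s. u s - v s) \<in> L2_space M"
proof -
  have meas: "(\<lambda>s. u s - v s) \<in> borel_measurable M"
    using L2_measurable[OF u] L2_measurable[OF v] by measurable
  have "integrable M (\<lambda>s. (cmod (u s - v s))\<^sup>2)"
  proof (rule Bochner_Integration.integrable_bound)
    show "integrable M (\<lambda>s. 2 * (cmod (u s))\<^sup>2 + 2 * (cmod (v s))\<^sup>2)"
      using u v by (intro Bochner_Integration.integrable_add integrable_mult_right L2_integrable)
    show "(\<lambda>s. (cmod (u s - v s))\<^sup>2) \<in> borel_measurable M"
      using meas by measurable
    have "(cmod (u s - v s))\<^sup>2 \<le> 2 * (cmod (u s))\<^sup>2 + 2 * (cmod (v s))\<^sup>2" for s
    proof -
      have "(cmod (u s - v s))\<^sup>2 \<le> (cmod (u s) + cmod (v s))\<^sup>2"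
        by (intro power_mono norm_triangle_ineq4) simp
      also have "\<dots> \<le> 2 * (cmod (u s))\<^sup>2 + 2 * (cmod (v s))\<^sup>2"
        using sum_squares_bound[of "cmod (u s)" "cmod (v s)"] by (simp add: power2_sum)
      finally show ?thesis .
    qed
    then show "AE s in M. norm ((cmod (u s - v s))\<^sup>2) \<le> norm (2 * (cmod (u s))\<^sup>2 + 2 * (cmod (v s))\<^sup>2)"
      by simp
  qed
  with meas show ?thesis by (simp add: L2_space_def)
qed

lemma L2_diff_scale:
  fixes u v :: "'a \<Rightarrow> complex"
  assumes "u \<in> L2_space M" "v \<in> L2_space M"
  shows "(\<lambda>s. u s - c * v s) \<in> L2_space M"
  by (intro L2_diff L2_scale assms)

lemma l2_inner_commute: "l2_inner M v u = cnj (l2_inner M u v)"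
proof -
  have "cnj (l2_inner M u v) = (\<integral>s. cnj (u s * cnj (v s)) \<partial>M)"
    unfolding l2_inner_def by (rule Bochner_Integration.integral_cnj[symmetric])
  then show ?thesis
    by (simp add: l2_inner_def mult.commute del: Bochner_Integration.integral_cnj)
qed

lemma l2_inner_self: "l2_inner M u u = of_real (l2_sqnorm M u)"
  by (simp add: l2_inner_def l2_sqnorm_def complex_norm_square[symmetric] flip: integral_complex_of_real)

lemma l2_inner_diff_scale_left:
  assumes "u \<in> L2_space M" "v \<in> L2_space M" "w \<in> L2_space M"
  shows "l2_inner M (\<lambda>s. u s - c * v s) w = l2_inner M u w - c * l2_inner M v w"
proof -
  have "l2_inner M (\<lambda>s. u s - c * v s) w = (\<integral>s. u s * cnj (w s) - c * (v s * cnj (w s)) \<partial>M)"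
    unfolding l2_inner_def by (simp add: algebra_simps)
  also have "\<dots> = l2_inner M u w - c * l2_inner M v w"
    using assms by (simp add: l2_inner_def L2_integrable_mult_cnj)
  finally show ?thesis .
qed

lemma l2_inner_diff_scale_right:
  assumes "u \<in> L2_space M" "v \<in> L2_space M" "w \<in> L2_space M"
  shows "l2_inner M w (\<lambda>s. u s - c * v s) = l2_inner M w u - cnj c * l2_inner M w v"
  using l2_inner_diff_scale_left[OF assms, of c]
  by (simp add: l2_inner_commute[of M w])

text \<open>The modulus of the inner product is at most \<open>\<integral>\<bar>u\<bar>\<bar>v\<bar>\<close>, so the inequality for nonnegative integrals suffices.\<close>

lemma l2_Cauchy_Schwarz:
  assumes u: "u \<in> L2_space M" and v: "v \<in> L2_space M"
  shows "(cmod (l2_inner M u v))\<^sup>2 \<le> l2_sqnorm M u * l2_sqnorm M v"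
proof -
  note [measurable] = L2_measurable[OF u] L2_measurable[OF v]
  define I where "I = (\<integral>s. cmod (u s) * cmod (v s) \<partial>M)"
  have int: "integrable M (\<lambda>s. cmod (u s) * cmod (v s))"
    using integrable_norm[OF L2_integrable_mult_cnj[OF u v]] by (simp add: norm_mult)
  have I0: "0 \<le> I"
    by (simp add: I_def)
  have "(\<integral>\<^sup>+s. ennreal (cmod (u s)) * ennreal (cmod (v s)) \<partial>M)\<^sup>2 \<le>
        (\<integral>\<^sup>+s. (ennreal (cmod (u s)))\<^sup>2 \<partial>M) * (\<integral>\<^sup>+s. (ennreal (cmod (v s)))\<^sup>2 \<partial>M)"
    by (rule Cauchy_Schwarz_nn_integral) measurable
  also have "(\<integral>\<^sup>+s. ennreal (cmod (u s)) * ennreal (cmod (v s)) \<partial>M) = ennreal I"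
    using nn_integral_eq_integral[OF int] by (simp add: I_def ennreal_mult)
  also have "(\<integral>\<^sup>+s. (ennreal (cmod (u s)))\<^sup>2 \<partial>M) = ennreal (l2_sqnorm M u)"
    using nn_integral_eq_integral[OF L2_integrable[OF u]] by (simp add: l2_sqnorm_def ennreal_power)
  also have "(\<integral>\<^sup>+s. (ennreal (cmod (v s)))\<^sup>2 \<partial>M) = ennreal (l2_sqnorm M v)"
    using nn_integral_eq_integral[OF L2_integrable[OF v]] by (simp add: l2_sqnorm_def ennreal_power)
  finally have "I\<^sup>2 \<le> l2_sqnorm M u * l2_sqnorm M v"
    using I0 l2_sqnorm_nonneg[of M u] l2_sqnorm_nonneg[of M v]
    by (simp add: ennreal_power flip: ennreal_mult)
  moreover have "cmod (l2_inner M u v) \<le> I"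
    using integral_norm_bound[of M "\<lambda>s. u s * cnj (v s)"]
    by (simp add: l2_inner_def I_def norm_mult)
  ultimately show ?thesis
    by (meson norm_ge_zero order_trans power_mono)
qed

section \<open>The inequality for complex functions\<close>

text \<open>
  Re-centring at the midpoint of \<open>\<phi>\<close> and \<open>\<Phi>\<close> makes the integrand of the gap a difference of two
  squares, one of which integrates to the squared half-diameter.
\<close>

lemma gap_complex_eq:
  assumes f: "f \<in> L2_space M" and h: "h \<in> L2_space M" and unit: "l2_sqnorm M h = 1"
  shows "gap_complex M h \<phi> \<Phi> f =
    (cmod (\<Phi> - \<phi>) / 2)\<^sup>2 - l2_sqnorm M (\<lambda>s. f s - (\<Phi> + \<phi>) / 2 * h s)"
proof -
  have diff_squares: "Re ((a - b) * cnj (a + b)) = (cmod a)\<^sup>2 - (cmod b)\<^sup>2" for a b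
    unfolding cmod_power2 by (simp add: power2_eq_square algebra_simps)
  have "Re ((\<Phi> * h s - f s) * (cnj (f s) - cnj \<phi> * cnj (h s))) =
        (cmod (\<Phi> - \<phi>) / 2)\<^sup>2 * (cmod (h s))\<^sup>2 - (cmod (f s - (\<Phi> + \<phi>) / 2 * h s))\<^sup>2" for s
  proof -
    have "Re ((\<Phi> * h s - f s) * (cnj (f s) - cnj \<phi> * cnj (h s))) =
        (cmod ((\<Phi> - \<phi>) / 2 * h s))\<^sup>2 - (cmod (f s - (\<Phi> + \<phi>) / 2 * h s))\<^sup>2"
      unfolding diff_squares[symmetric] by (simp add: field_simps)
    also have "(cmod ((\<Phi> - \<phi>) / 2 * h s))\<^sup>2 = (cmod (\<Phi> - \<phi>) / 2)\<^sup>2 * (cmod (h s))\<^sup>2"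
      by (simp add: norm_mult norm_divide power_mult_distrib power_divide)
    finally show ?thesis .
  qed
  then have "gap_complex M h \<phi> \<Phi> f = (\<integral>s. (cmod (\<Phi> - \<phi>) / 2)\<^sup>2 * (cmod (h s))\<^sup>2
      - (cmod (f s - (\<Phi> + \<phi>) / 2 * h s))\<^sup>2 \<partial>M)"
    by (simp add: gap_complex_def)
  also have "\<dots> = (cmod (\<Phi> - \<phi>) / 2)\<^sup>2 * l2_sqnorm M h
      - l2_sqnorm M (\<lambda>s. f s - (\<Phi> + \<phi>) / 2 * h s)"
    unfolding l2_sqnorm_def
    using L2_integrable[OF h] L2_integrable[OF L2_diff_scale[OF f h, of "(\<Phi> + \<phi>) / 2"]]
    by (subst Bochner_Integration.integral_diff) auto
  finally show ?thesis
    by (simp add: unit)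
qed

lemma gap_complex_nonneg_iff:
  assumes "f \<in> L2_space M" "h \<in> L2_space M" "l2_sqnorm M h = 1"
  shows "gap_complex M h \<phi> \<Phi> f \<ge> 0 \<longleftrightarrow>
    sqrt (l2_sqnorm M (\<lambda>s. f s - (\<Phi> + \<phi>) / 2 * h s)) \<le> 1/2 * cmod (\<Phi> - \<phi>)"
  using gap_complex_eq[OF assms, of \<phi> \<Phi>]
    real_sqrt_le_iff[of "l2_sqnorm M (\<lambda>s. f s - (\<Phi> + \<phi>) / 2 * h s)" "(cmod (\<Phi> - \<phi>) / 2)\<^sup>2"]
  by simp

text \<open>Pythagoras: \<open>f - d h\<close> has the component \<open>(\<langle>f,h\<rangle> - d) h\<close> along the unit vector \<open>h\<close>.\<close>

lemma l2_sqnorm_orthogonal_component_le: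
  assumes f: "f \<in> L2_space M" and h: "h \<in> L2_space M" and unit: "l2_sqnorm M h = 1"
  shows "l2_sqnorm M (\<lambda>s. f s - l2_inner M f h * h s) \<le> l2_sqnorm M (\<lambda>s. f s - d * h s)"
proof -
  define a where "a = l2_inner M f h"
  have hf: "l2_inner M h f = cnj a"
    using l2_inner_commute[of M h f] by (simp add: a_def)
  have hh: "l2_inner M h h = 1"
    by (simp add: l2_inner_self unit)
  have expand: "complex_of_real (l2_sqnorm M (\<lambda>s. f s - c * h s)) =
      of_real (l2_sqnorm M f - (cmod a)\<^sup>2 + (cmod (a - c))\<^sup>2)" for c
  proof -
    have "complex_of_real (l2_sqnorm M (\<lambda>s. f s - c * h s)) =
        l2_inner M f f - cnj c * a - c * (cnj a - cnj c)"
      using f h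
      by (simp add: l2_inner_self[symmetric] l2_inner_diff_scale_left l2_inner_diff_scale_right
          L2_diff_scale hf hh a_def[symmetric])
    also have "\<dots> = of_real (l2_sqnorm M f - (cmod a)\<^sup>2 + (cmod (a - c))\<^sup>2)"
      by (simp add: l2_inner_self complex_norm_square algebra_simps del: of_real_power)
    finally show ?thesis .
  qed
  have "l2_sqnorm M (\<lambda>s. f s - c * h s) = l2_sqnorm M f - (cmod a)\<^sup>2 + (cmod (a - c))\<^sup>2" for c
    using expand[of c] of_real_eq_iff by blast
  then show ?thesis
    by (simp add: a_def)
qed

text \<open>
  The covariance-like expression is the inner product of the component of \<open>f\<close> orthogonal to \<open>h\<close> with
  any translate \<open>g - e h\<close>, which leaves \<open>d\<close> and \<open>e\<close> free to be chosen.
\<close>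

lemma Gruss_bound:
  assumes f: "f \<in> L2_space M" and g: "g \<in> L2_space M" and h: "h \<in> L2_space M"
    and unit: "l2_sqnorm M h = 1"
  shows "(cmod (l2_inner M f g - l2_inner M f h * l2_inner M h g))\<^sup>2 \<le>
    l2_sqnorm M (\<lambda>s. f s - d * h s) * l2_sqnorm M (\<lambda>s. g s - e * h s)"
proof -
  define v where "v = (\<lambda>s. f s - l2_inner M f h * h s)"
  have v: "v \<in> L2_space M"
    unfolding v_def by (intro L2_diff_scale f h)
  have orth: "l2_inner M v h = 0"
    unfolding v_def using f h by (simp add: l2_inner_diff_scale_left l2_inner_self unit)
  have "l2_inner M f g - l2_inner M f h * l2_inner M h g = l2_inner M v g"
    unfolding v_def using f g h by (simp add: l2_inner_diff_scale_left)
  also have "\<dots> = l2_inner M v (\<lambda>s. g s - e * h s)"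
    using g h v by (simp add: l2_inner_diff_scale_right orth)
  finally have "(cmod (l2_inner M f g - l2_inner M f h * l2_inner M h g))\<^sup>2 \<le>
      l2_sqnorm M v * l2_sqnorm M (\<lambda>s. g s - e * h s)"
    using l2_Cauchy_Schwarz[OF v L2_diff_scale[OF g h]] by simp
  also have "\<dots> \<le> l2_sqnorm M (\<lambda>s. f s - d * h s) * l2_sqnorm M (\<lambda>s. g s - e * h s)"
    unfolding v_def
    by (intro mult_right_mono l2_sqnorm_orthogonal_component_le l2_sqnorm_nonneg f h unit)
  finally show ?thesis .
qed

text \<open>
  Aczel's inequality: with \<open>a = sqrt p\<close> and \<open>b = sqrt q\<close> the difference
  \<open>(m n - a b)\<^sup>2 - (m\<^sup>2 - a\<^sup>2) (n\<^sup>2 - b\<^sup>2)\<close> is the square \<open>(m b - n a)\<^sup>2\<close>.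
\<close>

lemma Aczel_inequality:
  fixes m n p q x :: real
  assumes "0 \<le> m" "0 \<le> n" "0 \<le> p" "p \<le> m\<^sup>2" "0 \<le> q" "q \<le> n\<^sup>2"
    and x: "x\<^sup>2 \<le> (m\<^sup>2 - p) * (n\<^sup>2 - q)"
  shows "x \<le> m * n - sqrt (p * q)"
proof (rule power2_le_imp_le)
  have "p = (sqrt p)\<^sup>2" "q = (sqrt q)\<^sup>2"
    using assms by simp_all
  then have "(m\<^sup>2 - p) * (n\<^sup>2 - q) = (m * n - sqrt p * sqrt q)\<^sup>2 - (m * sqrt q - n * sqrt p)\<^sup>2"
    by algebra
  with x show "x\<^sup>2 \<le> (m * n - sqrt (p * q))\<^sup>2"
    by (smt (verit) real_sqrt_mult zero_le_power2)
  have "sqrt p * sqrt q \<le> m * n"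
    using assms by (intro mult_mono real_le_lsqrt) auto
  then show "0 \<le> m * n - sqrt (p * q)"
    by (simp add: real_sqrt_mult)
qed

lemma Gruss_complex:
  assumes f: "f \<in> L2_space M" and g: "g \<in> L2_space M" and h: "h \<in> L2_space M"
    and unit: "l2_sqnorm M h = 1"
    and "gap_complex M h \<phi> \<Phi> f \<ge> 0" "gap_complex M h \<gamma> \<Gamma> g \<ge> 0"
  shows "cmod (l2_inner M f g - l2_inner M f h * l2_inner M h g) \<le>
    1/4 * cmod (\<Phi> - \<phi>) * cmod (\<Gamma> - \<gamma>) - sqrt (gap_complex M h \<phi> \<Phi> f * gap_complex M h \<gamma> \<Gamma> g)"
proof -
  note gf = gap_complex_eq[OF f h unit, of \<phi> \<Phi>]
  note gg = gap_complex_eq[OF g h unit, of \<gamma> \<Gamma>]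
  have "cmod (l2_inner M f g - l2_inner M f h * l2_inner M h g) \<le>
    cmod (\<Phi> - \<phi>) / 2 * (cmod (\<Gamma> - \<gamma>) / 2)
      - sqrt (gap_complex M h \<phi> \<Phi> f * gap_complex M h \<gamma> \<Gamma> g)"
  proof (rule Aczel_inequality)
    show "(cmod (l2_inner M f g - l2_inner M f h * l2_inner M h g))\<^sup>2 \<le>
      ((cmod (\<Phi> - \<phi>) / 2)\<^sup>2 - gap_complex M h \<phi> \<Phi> f) *
      ((cmod (\<Gamma> - \<gamma>) / 2)\<^sup>2 - gap_complex M h \<gamma> \<Gamma> g)"
      unfolding gf gg
      using Gruss_bound[OF f g h unit, of "(\<Phi> + \<phi>) / 2" "(\<Gamma> + \<gamma>) / 2"] by simp
    show "gap_complex M h \<phi> \<Phi> f \<le> (cmod (\<Phi> - \<phi>) / 2)\<^sup>2"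
      unfolding gf by (simp add: l2_sqnorm_nonneg)
    show "gap_complex M h \<gamma> \<Gamma> g \<le> (cmod (\<Gamma> - \<gamma>) / 2)\<^sup>2"
      unfolding gg by (simp add: l2_sqnorm_nonneg)
  qed (use assms in simp_all)
  then show ?thesis by simp
qed

section \<open>Real functions as complex functions\<close>

lemma L2_complex_of_real:
  fixes f :: "'a \<Rightarrow> real"
  assumes "f \<in> L2_space M"
  shows "(\<lambda>s. complex_of_real (f s)) \<in> L2_space M"
  using assms by (auto simp: L2_space_def)

lemma gap_complex_of_real:
  "gap_complex M (\<lambda>s. of_real (h s)) (of_real \<phi>) (of_real \<Phi>) (\<lambda>s. of_real (f s)) = gap_real M h \<phi> \<Phi> f"
  by (simp add: gap_complex_def gap_real_def)

lemma l2_inner_of_real: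
  "l2_inner M (\<lambda>s. of_real (f s)) (\<lambda>s. of_real (g s)) = of_real (\<integral>s. f s * g s \<partial>M)"
  by (simp add: l2_inner_def flip: of_real_mult)

lemma l2_sqnorm_of_real: "l2_sqnorm M (\<lambda>s. of_real (f s)) = (\<integral>s. \<bar>f s\<bar>\<^sup>2 \<partial>M)"
  by (simp add: l2_sqnorm_def)

lemma gap_real_nonneg_iff:
  assumes f: "f \<in> L2_space M" and h: "h \<in> L2_space M" and unit: "(\<integral>s. \<bar>h s\<bar>\<^sup>2 \<partial>M) = 1"
  shows "gap_real M h \<phi> \<Phi> f \<ge> 0 \<longleftrightarrow>
    sqrt (\<integral>s. \<bar>f s - (\<Phi> + \<phi>) / 2 * h s\<bar>\<^sup>2 \<partial>M) \<le> 1/2 * \<bar>\<Phi> - \<phi>\<bar>"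
proof -
  have centred: "(\<lambda>s. complex_of_real (f s) - (of_real \<Phi> + of_real \<phi>) / 2 * of_real (h s)) =
      (\<lambda>s. of_real (f s - (\<Phi> + \<phi>) / 2 * h s))"
    by simp
  have "l2_sqnorm M (\<lambda>s. of_real (h s)) = 1"
    using unit by (simp only: l2_sqnorm_of_real)
  from gap_complex_nonneg_iff[OF L2_complex_of_real[OF f] L2_complex_of_real[OF h] this,
      of "of_real \<phi>" "of_real \<Phi>"]
  show ?thesis
    unfolding gap_complex_of_real centred l2_sqnorm_of_real of_real_diff[symmetric] norm_of_real .
qed

lemma Gruss_real:
  assumes f: "f \<in> L2_space M" and g: "g \<in> L2_space M" and h: "h \<in> L2_space M"
    and unit: "(\<integral>s. \<bar>h s\<bar>\<^sup>2 \<partial>M) = 1"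
    and gaps: "gap_real M h \<phi> \<Phi> f \<ge> 0" "gap_real M h \<gamma> \<Gamma> g \<ge> 0"
  shows "\<bar>(\<integral>s. f s * g s \<partial>M) - (\<integral>s. f s * h s \<partial>M) * (\<integral>s. h s * g s \<partial>M)\<bar> \<le>
    1/4 * \<bar>\<Phi> - \<phi>\<bar> * \<bar>\<Gamma> - \<gamma>\<bar> - sqrt (gap_real M h \<phi> \<Phi> f * gap_real M h \<gamma> \<Gamma> g)"
proof -
  have "l2_sqnorm M (\<lambda>s. of_real (h s)) = 1"
    using unit by (simp only: l2_sqnorm_of_real)
  from Gruss_complex[OF L2_complex_of_real[OF f] L2_complex_of_real[OF g] L2_complex_of_real[OF h]
      this, of "of_real \<phi>" "of_real \<Phi>" "of_real \<gamma>" "of_real \<Gamma>"]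
  show ?thesis
    unfolding gap_complex_of_real l2_inner_of_real of_real_mult[symmetric] of_real_diff[symmetric]
      norm_of_real
    using gaps by blast
qed

section \<open>Sharpness: the fair random sign\<close>

abbreviation sign_measure :: "real measure" where
  "sign_measure \<equiv> uniform_count_measure {-1, 1}"

lemma integral_sign_measure:
  fixes F :: "real \<Rightarrow> 'b::{banach, second_countable_topology}"
  shows "(\<integral>s. F s \<partial>sign_measure) = (1/2) *\<^sub>R (F (-1) + F 1)"
  unfolding uniform_count_measure_def
  by (subst lebesgue_integral_point_measure_finite) (auto simp: scaleR_add_right)

lemma L2_sign_measure:
  fixes F :: "real \<Rightarrow> 'b::{real_normed_field, banach, second_countable_topology}"
  shows "F \<in> L2_space sign_measure"
proof -
  have "integrable sign_measure (\<lambda>s. (norm (F s))\<^sup>2)"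
    unfolding uniform_count_measure_def by (rule integrable_point_measure_finite) simp
  then show ?thesis
    by (simp add: L2_space_def measurable_def space_uniform_count_measure sets_uniform_count_measure)
qed

lemma Gruss_real_sharp:
  assumes "c < 1/4"
  shows "\<exists>N :: real measure.
    \<exists>f\<in>L2_space N. \<exists>g\<in>L2_space N. \<exists>h\<in>L2_space N. \<exists>\<phi> \<Phi> \<gamma> \<Gamma> :: real.
      (\<integral>s. \<bar>h s\<bar>\<^sup>2 \<partial>N) = 1 \<and>
      gap_real N h \<phi> \<Phi> f \<ge> 0 \<and> gap_real N h \<gamma> \<Gamma> g \<ge> 0 \<and>
      \<not> (\<bar>(\<integral>s. f s * g s \<partial>N) - (\<integral>s. f s * h s \<partial>N) * (\<integral>s. h s * g s \<partial>N)\<bar>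
        \<le> c * \<bar>\<Phi> - \<phi>\<bar> * \<bar>\<Gamma> - \<gamma>\<bar> - sqrt (gap_real N h \<phi> \<Phi> f * gap_real N h \<gamma> \<Gamma> g))"
  by (rule exI[of _ sign_measure], rule bexI[of _ "\<lambda>s. s"], rule bexI[of _ "\<lambda>s. s"],
      rule bexI[of _ "\<lambda>_. 1"], rule exI[of _ "-1"], rule exI[of _ 1],
      rule exI[of _ "-1"], rule exI[of _ 1])
    (use assms in \<open>simp_all add: integral_sign_measure gap_real_def L2_sign_measure
      space_uniform_count_measure measure_uniform_count_measure\<close>)

lemma Gruss_complex_sharp:
  assumes "c < 1/4"
  shows "\<exists>N :: real measure.
    \<exists>f\<in>L2_space N. \<exists>g\<in>L2_space N. \<exists>h\<in>L2_space N. \<exists>\<phi> \<Phi> \<gamma> \<Gamma> :: complex.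
      (\<integral>s. (cmod (h s))\<^sup>2 \<partial>N) = 1 \<and>
      gap_complex N h \<phi> \<Phi> f \<ge> 0 \<and> gap_complex N h \<gamma> \<Gamma> g \<ge> 0 \<and>
      \<not> (cmod ((\<integral>s. f s * cnj (g s) \<partial>N) - (\<integral>s. f s * cnj (h s) \<partial>N) * (\<integral>s. h s * cnj (g s) \<partial>N))
        \<le> c * cmod (\<Phi> - \<phi>) * cmod (\<Gamma> - \<gamma>) - sqrt (gap_complex N h \<phi> \<Phi> f * gap_complex N h \<gamma> \<Gamma> g))"
  by (rule exI[of _ sign_measure], rule bexI[of _ "complex_of_real"], rule bexI[of _ "complex_of_real"],
      rule bexI[of _ "\<lambda>_. 1"], rule exI[of _ "-1"], rule exI[of _ 1],
      rule exI[of _ "-1"], rule exI[of _ 1])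
    (use assms in \<open>simp_all add: integral_sign_measure gap_complex_def L2_sign_measure
      space_uniform_count_measure measure_uniform_count_measure\<close>)

section \<open>The Gruss inequality in both scalar fields, with its best constant\<close>

theorem proposition2:
  fixes M :: "'a measure"
  shows
    "(\<forall>f\<in>L2_space M. \<forall>g\<in>L2_space M. \<forall>h\<in>L2_space M. \<forall>\<phi> \<Phi> \<gamma> \<Gamma> :: real.
        (\<integral>s. \<bar>h s\<bar>\<^sup>2 \<partial>M) = 1 \<longrightarrow>
          (gap_real M h \<phi> \<Phi> f \<ge> 0 \<longleftrightarrow>
            sqrt (\<integral>s. \<bar>f s - (\<Phi> + \<phi>) / 2 * h s\<bar>\<^sup>2 \<partial>M) \<le> 1/2 * \<bar>\<Phi> - \<phi>\<bar>) \<and>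
          (gap_real M h \<gamma> \<Gamma> g \<ge> 0 \<longleftrightarrow>
            sqrt (\<integral>s. \<bar>g s - (\<Gamma> + \<gamma>) / 2 * h s\<bar>\<^sup>2 \<partial>M) \<le> 1/2 * \<bar>\<Gamma> - \<gamma>\<bar>) \<and>
          (gap_real M h \<phi> \<Phi> f \<ge> 0 \<and> gap_real M h \<gamma> \<Gamma> g \<ge> 0 \<longrightarrow>
            \<bar>(\<integral>s. f s * g s \<partial>M) - (\<integral>s. f s * h s \<partial>M) * (\<integral>s. h s * g s \<partial>M)\<bar>
            \<le> 1/4 * \<bar>\<Phi> - \<phi>\<bar> * \<bar>\<Gamma> - \<gamma>\<bar>
               - sqrt (gap_real M h \<phi> \<Phi> f * gap_real M h \<gamma> \<Gamma> g))) \<and>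
     (\<forall>c<1/4. \<exists>N :: real measure.
        \<exists>f\<in>L2_space N. \<exists>g\<in>L2_space N. \<exists>h\<in>L2_space N. \<exists>\<phi> \<Phi> \<gamma> \<Gamma> :: real.
          (\<integral>s. \<bar>h s\<bar>\<^sup>2 \<partial>N) = 1 \<and>
          gap_real N h \<phi> \<Phi> f \<ge> 0 \<and> gap_real N h \<gamma> \<Gamma> g \<ge> 0 \<and>
          \<not> (\<bar>(\<integral>s. f s * g s \<partial>N) - (\<integral>s. f s * h s \<partial>N) * (\<integral>s. h s * g s \<partial>N)\<bar>
            \<le> c * \<bar>\<Phi> - \<phi>\<bar> * \<bar>\<Gamma> - \<gamma>\<bar>
               - sqrt (gap_real N h \<phi> \<Phi> f * gap_real N h \<gamma> \<Gamma> g))) \<and>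
     (\<forall>f\<in>L2_space M. \<forall>g\<in>L2_space M. \<forall>h\<in>L2_space M. \<forall>\<phi> \<Phi> \<gamma> \<Gamma> :: complex.
        (\<integral>s. (cmod (h s))\<^sup>2 \<partial>M) = 1 \<longrightarrow>
          (gap_complex M h \<phi> \<Phi> f \<ge> 0 \<longleftrightarrow>
            sqrt (\<integral>s. (cmod (f s - (\<Phi> + \<phi>) / 2 * h s))\<^sup>2 \<partial>M) \<le> 1/2 * cmod (\<Phi> - \<phi>)) \<and>
          (gap_complex M h \<gamma> \<Gamma> g \<ge> 0 \<longleftrightarrow>
            sqrt (\<integral>s. (cmod (g s - (\<Gamma> + \<gamma>) / 2 * h s))\<^sup>2 \<partial>M) \<le> 1/2 * cmod (\<Gamma> - \<gamma>)) \<and>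
          (gap_complex M h \<phi> \<Phi> f \<ge> 0 \<and> gap_complex M h \<gamma> \<Gamma> g \<ge> 0 \<longrightarrow>
            cmod ((\<integral>s. f s * cnj (g s) \<partial>M) - (\<integral>s. f s * cnj (h s) \<partial>M) * (\<integral>s. h s * cnj (g s) \<partial>M))
            \<le> 1/4 * cmod (\<Phi> - \<phi>) * cmod (\<Gamma> - \<gamma>)
               - sqrt (gap_complex M h \<phi> \<Phi> f * gap_complex M h \<gamma> \<Gamma> g))) \<and>
     (\<forall>c<1/4. \<exists>N :: real measure.
        \<exists>f\<in>L2_space N. \<exists>g\<in>L2_space N. \<exists>h\<in>L2_space N. \<exists>\<phi> \<Phi> \<gamma> \<Gamma> :: complex.
          (\<integral>s. (cmod (h s))\<^sup>2 \<partial>N) = 1 \<and>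
          gap_complex N h \<phi> \<Phi> f \<ge> 0 \<and> gap_complex N h \<gamma> \<Gamma> g \<ge> 0 \<and>
          \<not> (cmod ((\<integral>s. f s * cnj (g s) \<partial>N) - (\<integral>s. f s * cnj (h s) \<partial>N) * (\<integral>s. h s * cnj (g s) \<partial>N))
            \<le> c * cmod (\<Phi> - \<phi>) * cmod (\<Gamma> - \<gamma>)
               - sqrt (gap_complex N h \<phi> \<Phi> f * gap_complex N h \<gamma> \<Gamma> g)))"
  apply (intro conjI)
  subgoal
    by (blast intro: gap_real_nonneg_iff[THEN iffD1] gap_real_nonneg_iff[THEN iffD2] Gruss_real)
  subgoal
    using Gruss_real_sharp by blast
  subgoal
    using gap_complex_nonneg_iff[unfolded l2_sqnorm_def] Gruss_complex[unfolded l2_sqnorm_def l2_inner_def]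
    by blast
  subgoal
    using Gruss_complex_sharp by blast
  done

end
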